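(* Let $G=(V,E)$ be a finite directed graph with nodes $s,t$, initial battery charge $B_0$, battery capacity $\bar B$, and for each edge $e\in E$ differentiable consumption functions $c_{f,e}:[0,1]\to\mathbb{R}_{\ge0}$ and $c_{b,e}:[0,1]\to\mathbb{R}$. Assume that for each $e\in E$ there exists $\alpha^0_e\in[0,1]$ with $c_{b,e}(\alpha^0_e)=0$. Assume further that for every cycle $C=(e_1,\dots,e_k)$ in $G$, every choice of $\alpha_1,\dots,\alpha_k\in[0,1]$, every edge $\ell\in E$ and every $\alpha_\ell\in[0,1]$, \[ \frac{\sum_{i=1}^k c_{f,e_i}(\alpha_i)}{\left|\sum_{i=1}^k c_{b,e_i}(\alpha_i)\right|} > -\frac{\frac{d}{d\alpha}c_{f,\ell}(\alpha_\ell)}{\frac{d}{d\alpha}c_{b,\ell}(\alpha_\ell)}. \] Then the energy-optimal $s$-$t$-path with lowest fuel consumption contains no cycle.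
   Context: An $s$-$t$-path is a finite sequence of ordered pairs $(e_i,\alpha_i)$, $i=1,\dots,k_P$, with $e_i\in E$ and $\alpha_i\in[0,1]$, such that the edges fit head to tail, $e_1$ starts in $s$ and $e_{k_P}$ ends in $t$; edges may be repeated, with possibly different $\alpha$ values at different occurrences. The battery states are $B_i=B_{i-1}-c_{b,e_i}(\alpha_i)$ for $i=1,\dots,k_P$, and the path is feasible if $0\le B_i\le\bar B$ for all $i$. Its cost (fuel consumption) is $\sum_{i=1}^{k_P}c_{f,e_i}(\alpha_i)$. An energy-optimal $s$-$t$-path is a feasible $s$-$t$-path of minimum fuel consumption. The consumption functions are assumed conservative: for every cycle and every choice of the $\alpha$'s on it, the total fuel consumption or the total battery consumption on the cycle is positive.
   Formalization: False as stated if a surplus can overflow the battery; added: for cycles with positive total battery consumption the ratio also exceeds +c_f'/c_b' (automatic if -c_f'/c_b' ≥ 0 on all edges). Also assumed: c_b' is never 0, so the quotient is defined, and 0 ≤ B_0 ≤ capacity. *)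

theory Defs
  imports
    Complex_Main
    "HOL-Library.Extended_Real"
    "Graph_Theory.Arc_Walk"
begin

text \<open>
  A consumption function has type \<open>'e \<Rightarrow> real \<Rightarrow> real\<close>; only its values on arcs and on the
  interval from 0 to 1 matter. A path is a walk (arcs may be repeated) in which every occurrence
  of an arc carries its own control parameter. The empty list is a path from \<open>s\<close> to \<open>t\<close> exactly
  if \<open>s = t\<close> is a vertex.
\<close>

type_synonym 'e controlled = "('e \<times> real) list"

definition st_path :: "('v, 'e) pre_digraph \<Rightarrow> 'v \<Rightarrow> 'v \<Rightarrow> 'e controlled \<Rightarrow> bool" where
  "st_path G s t P \<longleftrightarrow> pre_digraph.awalk G s (map fst P) t \<and> snd ` set P \<subseteq> {0..1}"

text \<open>
  The library's \<open>cycle\<close> is a nonempty closed walk without repeated inner vertices, given by its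
  list of arcs; loops are cycles of length one. A walk that contains a nonempty closed walk also
  contains such a cycle as a contiguous part.
\<close>

definition controlled_cycle :: "('v, 'e) pre_digraph \<Rightarrow> 'e controlled \<Rightarrow> bool" where
  "controlled_cycle G C \<longleftrightarrow> pre_digraph.cycle G (map fst C) \<and> snd ` set C \<subseteq> {0..1}"

definition contains_cycle :: "('v, 'e) pre_digraph \<Rightarrow> 'e controlled \<Rightarrow> bool" where
  "contains_cycle G P \<longleftrightarrow> (\<exists>X C Y. P = X @ C @ Y \<and> pre_digraph.cycle G (map fst C))"

definition consumption :: "('e \<Rightarrow> real \<Rightarrow> real) \<Rightarrow> 'e controlled \<Rightarrow> real" where
  "consumption c P = (\<Sum>(e, \<alpha>)\<leftarrow>P. c e \<alpha>)"

primrec battery :: "('e \<Rightarrow> real \<Rightarrow> real) \<Rightarrow> real \<Rightarrow> 'e controlled \<Rightarrow> nat \<Rightarrow> real" where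
  "battery cb B0 P 0 = B0"
| "battery cb B0 P (Suc i) = battery cb B0 P i - cb (fst (P ! i)) (snd (P ! i))"

definition feasible :: "('e \<Rightarrow> real \<Rightarrow> real) \<Rightarrow> real \<Rightarrow> real \<Rightarrow> 'e controlled \<Rightarrow> bool" where
  "feasible cb B0 Bmax P \<longleftrightarrow>
     (\<forall>i\<in>{1..length P}. 0 \<le> battery cb B0 P i \<and> battery cb B0 P i \<le> Bmax)"

definition energy_optimal ::
  "('v, 'e) pre_digraph \<Rightarrow> ('e \<Rightarrow> real \<Rightarrow> real) \<Rightarrow> ('e \<Rightarrow> real \<Rightarrow> real) \<Rightarrow> real \<Rightarrow> real \<Rightarrow>
     'v \<Rightarrow> 'v \<Rightarrow> 'e controlled \<Rightarrow> bool" where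
  "energy_optimal G cf cb B0 Bmax s t P \<longleftrightarrow>
     st_path G s t P \<and> feasible cb B0 Bmax P \<and>
     (\<forall>Q. st_path G s t Q \<and> feasible cb B0 Bmax Q \<longrightarrow> consumption cf P \<le> consumption cf Q)"

definition conservative ::
  "('v, 'e) pre_digraph \<Rightarrow> ('e \<Rightarrow> real \<Rightarrow> real) \<Rightarrow> ('e \<Rightarrow> real \<Rightarrow> real) \<Rightarrow> bool" where
  "conservative G cf cb \<longleftrightarrow>
     (\<forall>C. controlled_cycle G C \<longrightarrow> consumption cf C > 0 \<or> consumption cb C > 0)"

text \<open>
  Fuel per unit of battery energy exchanged on a cycle. It is an extended real: \<open>\<infinity>\<close> if the battery
  balance is zero and fuel is consumed.
\<close>

definition exchange_ratio ::
  "('e \<Rightarrow> real \<Rightarrow> real) \<Rightarrow> ('e \<Rightarrow> real \<Rightarrow> real) \<Rightarrow> 'e controlled \<Rightarrow> ereal" where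
  "exchange_ratio cf cb C = ereal (consumption cf C) / ereal \<bar>consumption cb C\<bar>"

end

theory Submission
  imports Defs
begin

text \<open>
  Suppose an optimal path is \<open>X @ C @ Y\<close> with a cycle \<open>C\<close> of fuel \<open>F\<close> and battery balance \<open>S\<close>.
  Deleting \<open>C\<close> enters \<open>Y\<close> with a battery state that is off by \<open>\<bar>S\<bar>\<close>. If the battery is too low, run \<open>Y\<close>
  with each discharging arc moved towards its neutral control until the original battery state is
  reached; if it is too high, treat the charging arcs likewise. By Cauchy's mean value theorem the
  repair costs less than \<open>F / \<bar>S\<bar>\<close> per unit of battery energy, so less than the fuel \<open>F\<close> saved.
\<close>

lemma feasible_Nil [simp]: "feasible cb b M []"
  by (simp add: feasible_def)

lemma battery_Cons_Suc:
  "battery cb b (x # P) (Suc i) = battery cb (b - cb (fst x) (snd x)) P i"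
  by (induction i) auto

text \<open>Trades indexed battery states for a recursion on the list with a moving initial charge,
  the form in which all later inductions over paths run.\<close>

lemma feasible_Cons [simp]:
  "feasible cb b M (x # P) \<longleftrightarrow>
     b - cb (fst x) (snd x) \<in> {0..M} \<and> feasible cb (b - cb (fst x) (snd x)) M P"
proof -
  have *: "{1..length (x # P)} = insert 1 (Suc ` {1..length P})"
    by (simp flip: atLeastLessThanSuc_atLeastAtMost atLeast0_lessThan_Suc) auto
  have **: "battery cb b (x # P) 1 = b - cb (fst x) (snd x)"
    by simp
  show ?thesis
    unfolding feasible_def * ball_simps image_iff battery_Cons_Suc ** by auto
qed

lemma consumption_simps [simp]:
  "consumption c [] = 0"
  "consumption c (x # P) = c (fst x) (snd x) + consumption c P"
  "consumption c (P @ Q) = consumption c P + consumption c Q"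
  by (auto simp: consumption_def case_prod_unfold)

lemma feasible_append:
  "feasible cb b M (P @ Q) \<longleftrightarrow> feasible cb b M P \<and> feasible cb (b - consumption cb P) M Q"
  by (induction P arbitrary: b) (auto simp: diff_diff_eq)

text \<open>\<open>feasible\<close> tests states only from index 1 on, so the bound on the initial
  charge enters separately; it settles the empty path.\<close>

lemma feasible_final_state:
  "feasible cb b M P \<Longrightarrow> b \<in> {0..M} \<Longrightarrow> b - consumption cb P \<in> {0..M}"
proof (induction P arbitrary: b)
  case (Cons x P)
  then show ?case
    using Cons.IH[of "b - cb (fst x) (snd x)"] by (simp add: diff_diff_eq)
qed simp

text \<open>The free capacity \<open>M - b\<close> evolves like a charge under negated consumption,
  and the bounds 0 and \<open>M\<close> swap. This turns a surplus of charge into a deficit, so one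
  repair lemma serves both cases.\<close>

lemma feasible_mirror:
  "feasible (\<lambda>e \<alpha>. - cb e \<alpha>) (M - b) M P \<longleftrightarrow> feasible cb b M P"
proof (induction P arbitrary: b)
  case (Cons x P)
  have *: "M - b - - cb (fst x) (snd x) = M - (b - cb (fst x) (snd x))"
    by simp
  show ?case
    unfolding feasible_Cons * Cons by auto
qed simp

text \<open>The combination \<open>h\<close> below takes equal values at \<open>x\<close> and
  \<open>y\<close>, so its derivative vanishes in between. The two points may come in either order
  because a control may have to move up or down.\<close>

lemma cauchy_mvt_within:
  fixes f g f' g' :: "real \<Rightarrow> real"
  assumes "x \<in> {a..b}" "y \<in> {a..b}" "x \<noteq> y"
    and f: "\<And>z. z \<in> {a..b} \<Longrightarrow> (f has_real_derivative f' z) (at z within {a..b})"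
    and g: "\<And>z. z \<in> {a..b} \<Longrightarrow> (g has_real_derivative g' z) (at z within {a..b})"
  shows "\<exists>z\<in>{a..b}. (f y - f x) * g' z = (g y - g x) * f' z"
  using assms(1-3)
proof (induction x y rule: linorder_wlog)
  case (le x y)
  define h where "h z = (f y - f x) * g z - (g y - g x) * f z" for z
  define h' where "h' z = (f y - f x) * g' z - (g y - g x) * f' z" for z
  have h: "(h has_real_derivative h' z) (at z within {a..b})" if "z \<in> {a..b}" for z
    unfolding h_def h'_def
    by (intro DERIV_diff DERIV_cmult f g that)
  have xy: "x < y" "{x..y} \<subseteq> {a..b}"
    using le by auto
  have "continuous_on {a..b} h"
    using h by (rule DERIV_continuous_on)
  then have cont: "continuous_on {x..y} h"
    using xy(2) continuous_on_subset by blast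
  \<comment> \<open>Points strictly between \<open>x\<close> and \<open>y\<close> are interior to
    \<open>{a..b}\<close>, so the derivative within the interval is two-sided there.\<close>
  have deriv: "(h has_derivative (*) (h' z)) (at z)" if "x < z" "z < y" for z
    using h[of z] that le at_within_Icc_at[of a z b]
    by (auto simp: has_field_derivative_def)
  obtain z where z: "x < z" "z < y" "h y - h x = h' z * (y - x)"
    using mvt[OF xy(1) cont deriv] by blast
  have "h y - h x = 0"
    by (simp add: h_def algebra_simps)
  then have "h' z = 0"
    using z by auto
  then show ?case
    using z le by (intro bexI[of _ z]) (auto simp: h'_def)
next
  case (sym x y)
  then obtain z where "z \<in> {a..b}" "(f x - f y) * g' z = (g x - g y) * f' z"
    by blast
  then show ?case
    by (intro bexI[of _ z]) (auto simp: algebra_simps)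
qed

lemma IVT_Icc:
  fixes f :: "real \<Rightarrow> real"
  assumes "continuous_on {a..b} f" "u \<in> {a..b}" "v \<in> {a..b}" "f u \<le> y" "y \<le> f v"
  shows "\<exists>z\<in>{a..b}. f z = y"
proof -
  have "connected (f ` {a..b})"
    using assms(1) by (intro connected_continuous_image) auto
  then have "{f u..f v} \<subseteq> f ` {a..b}"
    using assms by (intro connected_contains_Icc) auto
  then show ?thesis
    using assms(4,5) by (fastforce simp: image_iff)
qed

text \<open>The intermediate value theorem supplies a control with \<open>g z = y\<close>; Cauchy's
  theorem turns the pointwise bound on \<open>- (f' z / g' z)\<close> into a bound for the finite
  change.\<close>

lemma reduce_discharge:
  fixes f g f' g' :: "real \<Rightarrow> real"
  assumes f: "\<And>z. z \<in> {a..b} \<Longrightarrow> (f has_real_derivative f' z) (at z within {a..b})"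
    and g: "\<And>z. z \<in> {a..b} \<Longrightarrow> (g has_real_derivative g' z) (at z within {a..b})"
    and g_nonzero: "\<And>z. z \<in> {a..b} \<Longrightarrow> g' z \<noteq> 0"
    and rate: "\<And>z. z \<in> {a..b} \<Longrightarrow> - (f' z / g' z) < r"
    and "x\<^sub>0 \<in> {a..b}" "g x\<^sub>0 \<le> y" "x \<in> {a..b}" "y < g x"
  shows "\<exists>z\<in>{a..b}. g z = y \<and> f z < f x + r * (g x - y)"
proof -
  have "continuous_on {a..b} g"
    using g by (rule DERIV_continuous_on)
  then obtain z where z: "z \<in> {a..b}" "g z = y"
    using IVT_Icc[of a b g x\<^sub>0 x y] assms by auto
  then have "x \<noteq> z"
    using assms by auto
  then obtain w where w: "w \<in> {a..b}" "(f z - f x) * g' w = (g z - g x) * f' w"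
    using cauchy_mvt_within[of x a b z f f' g g'] f g z assms(7) by blast
  have "f z - f x = - (f' w / g' w) * (g x - y)"
    using w g_nonzero[OF w(1)] z by (simp add: field_simps)
  also have "\<dots> < r * (g x - y)"
    using rate[OF w(1)] assms by (intro mult_strict_right_mono) auto
  finally show ?thesis
    using z by (intro bexI[of _ z]) auto
qed

text \<open>Follow \<open>Y\<close> while the deficit \<open>b - b'\<close> is positive. The
  repaired state stays between 0 and the original state, which gives feasibility, and each unit of
  deficit recovered costs less than \<open>r\<close>.\<close>

lemma repair_deficit:
  assumes reduce: "\<And>e \<alpha> y. e \<in> E \<Longrightarrow> \<alpha> \<in> {0..1} \<Longrightarrow> 0 \<le> y \<Longrightarrow> y < cb e \<alpha> \<Longrightarrow>
      \<exists>\<beta>\<in>{0..1}. cb e \<beta> = y \<and> cf e \<beta> < cf e \<alpha> + r * (cb e \<alpha> - y)"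
    and "r > 0"
    and "set (map fst Y) \<subseteq> E" "snd ` set Y \<subseteq> {0..1}"
    and "feasible cb b M Y" "0 \<le> b'" "b' < b" "b \<le> M"
  shows "\<exists>Y'. map fst Y' = map fst Y \<and> snd ` set Y' \<subseteq> {0..1} \<and> feasible cb b' M Y' \<and>
      consumption cf Y' < consumption cf Y + r * (b - b')"
  using assms(3-)
proof (induction Y arbitrary: b b')
  \<comment> \<open>A deficit may remain at the end; strictness then comes from \<open>r > 0\<close>
    and \<open>b' < b\<close>.\<close>
  case Nil
  then show ?case
    using \<open>r > 0\<close> by auto
next
  case (Cons x Y)
  obtain e \<alpha> where x: "x = (e, \<alpha>)"
    by fastforce
  have e: "e \<in> E" "\<alpha> \<in> {0..1}" and Y: "set (map fst Y) \<subseteq> E" "snd ` set Y \<subseteq> {0..1}"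
    "feasible cb (b - cb e \<alpha>) M Y" "0 \<le> b - cb e \<alpha>" "b - cb e \<alpha> \<le> M"
    using Cons.prems by (auto simp: x)
  have Cons_witness: ?case
    if "map fst Y' = map fst Y" "snd ` set Y' \<subseteq> {0..1}" "\<beta> \<in> {0..1}"
      "b' - cb e \<beta> \<in> {0..M}" "feasible cb (b' - cb e \<beta>) M Y'"
      "cf e \<beta> + consumption cf Y' < cf e \<alpha> + consumption cf Y + r * (b - b')" for \<beta> Y'
    using that by (intro exI[of _ "(e, \<beta>) # Y'"]) (auto simp: x)
  consider "cb e \<alpha> \<le> 0" | "0 < cb e \<alpha>" "cb e \<alpha> < b - b'" | "b - b' \<le> cb e \<alpha>"
    by linarith
  then show ?case
  proof cases
    \<comment> \<open>The control is kept and the whole deficit is passed on.\<close>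
    case 1
    obtain Y' where "map fst Y' = map fst Y" "snd ` set Y' \<subseteq> {0..1}"
      "feasible cb (b' - cb e \<alpha>) M Y'" "consumption cf Y' < consumption cf Y + r * (b - b')"
      using Cons.IH[OF Y(1-3), of "b' - cb e \<alpha>"] Y Cons.prems 1 by auto
    then show ?thesis
      using e Y Cons.prems 1 by (intro Cons_witness[of Y' \<alpha>]) auto
  next
    \<comment> \<open>Full neutralisation recovers only \<open>cb e \<alpha>\<close>; the rest of
      the deficit goes to the induction hypothesis.\<close>
    case 2
    obtain \<beta> where \<beta>: "\<beta> \<in> {0..1}" "cb e \<beta> = 0" "cf e \<beta> < cf e \<alpha> + r * cb e \<alpha>"
      using reduce[OF e, of 0] 2 by auto
    obtain Y' where "map fst Y' = map fst Y" "snd ` set Y' \<subseteq> {0..1}"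
      "feasible cb b' M Y'" "consumption cf Y' < consumption cf Y + r * (b - cb e \<alpha> - b')"
      using Cons.IH[OF Y(1-3), of b'] Y Cons.prems 2 by auto
    then show ?thesis
      using \<beta> Y Cons.prems by (intro Cons_witness[of Y' \<beta>]) (auto simp: algebra_simps)
  next
    \<comment> \<open>Lowering the discharge by exactly the deficit restores the original state, so
      the remaining arcs keep their controls.\<close>
    case 3
    obtain \<beta> where "\<beta> \<in> {0..1}" "cb e \<beta> = cb e \<alpha> - (b - b')" "cf e \<beta> < cf e \<alpha> + r * (b - b')"
      using reduce[OF e, of "cb e \<alpha> - (b - b')"] 3 Cons.prems by auto
    then show ?thesis
      using Y by (intro Cons_witness[of Y \<beta>]) auto
  qed
qed



theorem theorem1:
  fixes G :: "('v, 'e) pre_digraph"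
    and cf cb cf' cb' :: "'e \<Rightarrow> real \<Rightarrow> real"
    and B0 Bmax :: real and s t :: 'v
  assumes graph: "fin_digraph G" "s \<in> verts G" "t \<in> verts G"
    and charge: "0 \<le> B0" "B0 \<le> Bmax"
    and fuel_nonneg: "\<And>e \<alpha>. e \<in> arcs G \<Longrightarrow> \<alpha> \<in> {0..1} \<Longrightarrow> cf e \<alpha> \<ge> 0"
    and fuel_deriv: "\<And>e \<alpha>. e \<in> arcs G \<Longrightarrow> \<alpha> \<in> {0..1} \<Longrightarrow>
          (cf e has_real_derivative cf' e \<alpha>) (at \<alpha> within {0..1})"
    and battery_deriv: "\<And>e \<alpha>. e \<in> arcs G \<Longrightarrow> \<alpha> \<in> {0..1} \<Longrightarrow>
          (cb e has_real_derivative cb' e \<alpha>) (at \<alpha> within {0..1})"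
    and battery_deriv_nonzero: "\<And>e \<alpha>. e \<in> arcs G \<Longrightarrow> \<alpha> \<in> {0..1} \<Longrightarrow> cb' e \<alpha> \<noteq> 0"
    and conservative: "conservative G cf cb"
    and neutral: "\<And>e. e \<in> arcs G \<Longrightarrow> \<exists>\<alpha>\<^sub>0\<in>{0..1}. cb e \<alpha>\<^sub>0 = 0"
    and exchange: "\<And>C l \<alpha>. controlled_cycle G C \<Longrightarrow> l \<in> arcs G \<Longrightarrow> \<alpha> \<in> {0..1} \<Longrightarrow>
          exchange_ratio cf cb C > ereal (- (cf' l \<alpha> / cb' l \<alpha>))"
    and exchange_discharging: "\<And>C l \<alpha>. controlled_cycle G C \<Longrightarrow> consumption cb C > 0 \<Longrightarrow>
          l \<in> arcs G \<Longrightarrow> \<alpha> \<in> {0..1} \<Longrightarrow>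
          exchange_ratio cf cb C > ereal (cf' l \<alpha> / cb' l \<alpha>)"
    and optimal: "energy_optimal G cf cb B0 Bmax s t P"
  shows "\<not> contains_cycle G P"
proof
  interpret fin_digraph G
    by (fact graph)
  assume "contains_cycle G P"
  then obtain X C Y where P: "P = X @ C @ Y" and cyc: "cycle (map fst C)"
    by (auto simp: contains_cycle_def)
  have walk: "awalk s (map fst X @ map fst C @ map fst Y) t"
    and controls: "snd ` set X \<subseteq> {0..1}" "snd ` set C \<subseteq> {0..1}" "snd ` set Y \<subseteq> {0..1}"
    and feas: "feasible cb B0 Bmax P"
    and opt: "\<And>Q. st_path G s t Q \<Longrightarrow> feasible cb B0 Bmax Q \<Longrightarrow> consumption cf P \<le> consumption cf Q"
    using optimal by (auto simp: energy_optimal_def st_path_def P)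
  have C: "controlled_cycle G C"
    using cyc controls by (simp add: controlled_cycle_def)
  define F where "F = consumption cf C"
  define S where "S = consumption cb C"
  define b where "b = B0 - consumption cb X"
  have feas_X: "feasible cb B0 Bmax X" and feas_C: "feasible cb b Bmax C"
    and feas_Y: "feasible cb (b - S) Bmax Y"
    using feas by (auto simp: P feasible_append b_def S_def)
  have b: "b \<in> {0..Bmax}"
    using feasible_final_state[OF feas_X] charge by (auto simp: b_def)
  then have bS: "b - S \<in> {0..Bmax}"
    using feasible_final_state[OF feas_C] by (simp add: S_def)
  have walk_XY: "awalk s (map fst X @ map fst Y) t"
  proof -
    obtain u where u: "awalk u (map fst C) u" and "map fst C \<noteq> []"
      using cyc by (auto simp: cycle_def)
    moreover have "awalk (awlast s (map fst X)) (map fst C)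
        (awlast (awlast s (map fst X)) (map fst C))"
      using walk by auto
    \<comment> \<open>The cycle ends where it starts, so \<open>Y\<close> departs from the vertex
      that \<open>X\<close> reaches.\<close>
    ultimately show ?thesis
      using walk awalk_ends[OF u] by (metis awalk_append_iff)
  qed
  have arcs_Y: "set (map fst Y) \<subseteq> arcs G"
    using walk_XY by (auto simp: awalk_def)
  have too_cheap: False
    if "map fst Y' = map fst Y" "snd ` set Y' \<subseteq> {0..1}" "feasible cb b Bmax Y'"
      "consumption cf Y' < consumption cf Y + F" for Y'
  proof -
    have "st_path G s t (X @ Y')"
      using that walk_XY controls by (auto simp: st_path_def)
    moreover have "feasible cb B0 Bmax (X @ Y')"
      using that feas_X by (simp add: feasible_append b_def)
    ultimately show False
      using opt[of "X @ Y'"] that by (simp add: P F_def)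
  qed
  \<comment> \<open>For \<open>S = 0\<close> and \<open>F > 0\<close> the extended ratio is
    infinite, whereas real division yields 0.\<close>
  have ratio: "exchange_ratio cf cb C = ereal (F / \<bar>S\<bar>)" if "S \<noteq> 0"
    using that by (simp add: exchange_ratio_def F_def S_def)
  have F_or_S: "F > 0 \<or> S > 0"
    using conservative C by (auto simp: conservative_def F_def S_def)
  consider "S = 0" | "S < 0" | "S > 0"
    by linarith
  then show False
  proof cases
    case 1
    then show False
      using too_cheap[of Y] controls feas_Y F_or_S by auto
  next
    \<comment> \<open>The cycle charges the battery, so without it \<open>Y\<close> lacks
      \<open>-S\<close>. At rate \<open>F / \<bar>S\<bar>\<close> the repair stays below
      \<open>F\<close>, and conservativeness makes this rate positive.\<close>
    case 2
    have reduce: "\<exists>\<beta>\<in>{0..1}. cb e \<beta> = y \<and> cf e \<beta> < cf e \<alpha> + F / \<bar>S\<bar> * (cb e \<alpha> - y)"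
      if e: "e \<in> arcs G" "\<alpha> \<in> {0..1}" "0 \<le> y" "y < cb e \<alpha>" for e \<alpha> y
    proof -
      obtain \<alpha>\<^sub>0 where "\<alpha>\<^sub>0 \<in> {0..1}" "cb e \<alpha>\<^sub>0 = 0"
        using neutral[OF e(1)] by blast
      then show ?thesis
        using e exchange[OF C] ratio 2
        by (intro reduce_discharge[OF fuel_deriv battery_deriv battery_deriv_nonzero]) auto
    qed
    have "F / \<bar>S\<bar> * (b - S - b) = F" "F / \<bar>S\<bar> > 0"
      using 2 F_or_S by (auto simp: divide_pos_neg)
    then show False
      using repair_deficit[of "arcs G" cb cf "F / \<bar>S\<bar>" Y "b - S" Bmax b] reduce too_cheap
        arcs_Y controls feas_Y b bS 2 by auto
  next
    \<comment> \<open>The cycle discharges, so \<open>Y\<close> now starts with surplus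
      \<open>S\<close>, a deficit of free capacity. Negating \<open>cb\<close> flips the sign of the
      derivative quotient, which is why \<open>exchange_discharging\<close> supplies the rate
      bound.\<close>
    case 3
    have reduce: "\<exists>\<beta>\<in>{0..1}. - cb e \<beta> = y \<and> cf e \<beta> < cf e \<alpha> + F / \<bar>S\<bar> * (- cb e \<alpha> - y)"
      if e: "e \<in> arcs G" "\<alpha> \<in> {0..1}" "0 \<le> y" "y < - cb e \<alpha>" for e \<alpha> y
    proof -
      obtain \<alpha>\<^sub>0 where "\<alpha>\<^sub>0 \<in> {0..1}" "cb e \<alpha>\<^sub>0 = 0"
        using neutral[OF e(1)] by blast
      then show ?thesis
        using e exchange_discharging[OF C] ratio 3 battery_deriv_nonzero
        by (intro reduce_discharge[OF fuel_deriv DERIV_minus[OF battery_deriv]]) (auto simp: S_def)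
    qed
    \<comment> \<open>Conservativeness says nothing about \<open>F\<close> when
      \<open>S > 0\<close>. Instead the rate exceeds both a number and its negative, taken at any
      arc of the cycle and control 0, hence is positive.\<close>
    obtain l where l: "l \<in> arcs G"
      using cyc by (cases "map fst C") (auto simp: cycle_def awalk_def)
    have "cf' l 0 / cb' l 0 < F / \<bar>S\<bar>" "- (cf' l 0 / cb' l 0) < F / \<bar>S\<bar>"
      using exchange[OF C l, of 0] exchange_discharging[OF C _ l, of 0] ratio 3
      by (auto simp: S_def)
    then have "F / \<bar>S\<bar> > 0"
      by linarith
    moreover have "F / \<bar>S\<bar> * (Bmax - (b - S) - (Bmax - b)) = F"
      using 3 by auto
    ultimately show False
      using repair_deficit[of "arcs G" "\<lambda>e \<alpha>. - cb e \<alpha>" cf "F / \<bar>S\<bar>" Y "Bmax - (b - S)" Bmax "Bmax - b"]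
        reduce too_cheap arcs_Y controls feas_Y b bS 3
      by (auto simp: feasible_mirror)
  qed
qed

end
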